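(* Let $r\ge 1$ be a fixed integer and let $\boldsymbol{\mu}=\{\mu_1,\ldots,\mu_r\}$ be a fixed probability distribution with $\mu_i>0$ for $i=1,\ldots,r$. Consider a scaling $\boldsymbol{\Theta}=(K_1,\ldots,K_r,P,\alpha):\mathbb{N}_0\to\mathbb{N}_0^{r+1}\times(0,1)$ such that $$\Lambda_1(n)=\alpha_n\lambda_1(n)\sim c\,\frac{\log n}{n}$$ for some $c>0$. Then $$\lim_{n\to\infty}\mathbb{P}\left[\mathbb{G}(n;\boldsymbol{\mu},\boldsymbol{\Theta}_n)\text{ has no isolated nodes}\right]=\begin{cases}0 & \text{if } c<1,\\ 1 & \text{if } c>1.\end{cases}$$
   Context: Random graph model. Given $n$, a probability distribution $\boldsymbol{\mu}=\{\mu_1,\ldots,\mu_r\}$, integers $K_1,\ldots,K_r,P$ and $\alpha\in(0,1)$: each of the nodes $v_1,\ldots,v_n$ is independently assigned a class $t_x\in\{1,\ldots,r\}$ with $\mathbb{P}[t_x=i]=\mu_i$. Given its class $t_x=i$, node $v_x$ receives a key ring $\Sigma_x$ drawn uniformly at random among all $K_i$-element subsets of $\{1,\ldots,P\}$, independently across nodes. The inhomogeneous random key graph $\mathbb{K}(n;\boldsymbol{\mu},\boldsymbol{K},P)$ has vertex set $\{v_1,\ldots,v_n\}$, and distinct $v_x,v_y$ are adjacent iff $\Sigma_x\cap\Sigma_y\neq\emptyset$. Independently, $\mathbb{H}(n;\alpha)$ is the Erdős–Rényi graph on the same vertices, in which each pair is adjacent with probability $\alpha$ independently of all other pairs. The graph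 $\mathbb{G}(n;\boldsymbol{\mu},\boldsymbol{\Theta})$, with $\boldsymbol{\Theta}=(K_1,\ldots,K_r,P,\alpha)$, is the intersection: two nodes are adjacent iff they are adjacent in both $\mathbb{K}(n;\boldsymbol{\mu},\boldsymbol{K},P)$ and $\mathbb{H}(n;\alpha)$. Edge probabilities: $p_{ij}=1-\binom{P-K_i}{K_j}/\binom{P}{K_j}$ (the probability that a class-$i$ and a class-$j$ node share a key, when $K_i+K_j\le P$), $\lambda_i=\sum_{j=1}^r\mu_jp_{ij}$, and $\Lambda_i=\alpha\lambda_i$. Scaling: a map $\boldsymbol{\Theta}=(K_1,\ldots,K_r,P,\alpha):\mathbb{N}_0\to\mathbb{N}_0^{r+1}\times(0,1)$, $n\mapsto\boldsymbol{\Theta}_n=(K_{1,n},\ldots,K_{r,n},P_n,\alpha_n)$, is called a scaling if $1\le K_{1,n}\le K_{2,n}\le\cdots\le K_{r,n}\le P_n/2$ for all $n=2,3,\ldots$. The quantities $p_{ij}(n),\lambda_i(n),\Lambda_i(n)$ are those obtained from the parameters $\boldsymbol{\Theta}_n$. The number of classes $r$ and the distribution $\boldsymbol{\mu}$ do not depend on $n$. The notation $a_n\sim b_n$ means $\lim_{n\to\infty}a_n/b_n=1$. *)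

theory Defs
  imports "HOL-Probability.Probability" "HOL-Library.Landau_Symbols"
begin

text \<open>
  Graphs on the nodes \<open>v\<^sub>1, \<dots>, v\<^sub>n\<close> have vertex set \<open>{1..n}\<close> and are
  given by their edge sets, whose members are two-element sets of vertices.
\<close>

definition node_pairs :: "nat \<Rightarrow> nat set set" where
  "node_pairs n = {{x, y} | x y. x \<in> {1..n} \<and> y \<in> {1..n} \<and> x \<noteq> y}"

definition isolated :: "nat set set \<Rightarrow> nat \<Rightarrow> bool" where
  "isolated E v \<longleftrightarrow> (\<forall>e\<in>E. v \<notin> e)"

definition no_isolated_nodes :: "nat \<Rightarrow> nat set set \<Rightarrow> bool" where
  "no_isolated_nodes n E \<longleftrightarrow> \<not> (\<exists>v\<in>{1..n}. isolated E v)"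

definition key_rings :: "nat \<Rightarrow> nat \<Rightarrow> nat set set" where
  "key_rings P k = {S. S \<subseteq> {1..P} \<and> card S = k}"

text \<open>
  Joint law of the class and the key ring of a single node. It is meaningful when
  \<open>K i \<le> P\<close> for every class \<open>i\<close>, as \<^const>\<open>pmf_of_set\<close> is unspecified on the
  empty set.
\<close>

definition node_pmf :: "nat pmf \<Rightarrow> (nat \<Rightarrow> nat) \<Rightarrow> nat \<Rightarrow> (nat \<times> nat set) pmf" where
  "node_pmf \<mu> K P =
     bind_pmf \<mu> (\<lambda>i. map_pmf (\<lambda>S. (i, S)) (pmf_of_set (key_rings P (K i))))"

definition key_graph :: "nat \<Rightarrow> (nat \<Rightarrow> nat \<times> nat set) \<Rightarrow> nat set set" where
  "key_graph n \<omega> =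
     {{x, y} | x y. x \<in> {1..n} \<and> y \<in> {1..n} \<and> x \<noteq> y \<and> snd (\<omega> x) \<inter> snd (\<omega> y) \<noteq> {}}"

text \<open>
  \<open>Pi_pmf A d p\<close> is the law of independent variables indexed by \<open>A\<close>; the value \<open>d\<close>
  outside \<open>A\<close> plays no role below.
\<close>

definition random_key_graph :: "nat \<Rightarrow> nat pmf \<Rightarrow> (nat \<Rightarrow> nat) \<Rightarrow> nat \<Rightarrow> nat set set pmf" where
  "random_key_graph n \<mu> K P =
     map_pmf (key_graph n) (Pi_pmf {1..n} (0, {}) (\<lambda>_. node_pmf \<mu> K P))"

definition erdos_renyi_graph :: "nat \<Rightarrow> real \<Rightarrow> nat set set pmf" where
  "erdos_renyi_graph n \<alpha> =
     map_pmf (\<lambda>b. {e \<in> node_pairs n. b e})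
       (Pi_pmf (node_pairs n) False (\<lambda>_. bernoulli_pmf \<alpha>))"

definition intersection_graph ::
    "nat \<Rightarrow> nat pmf \<Rightarrow> (nat \<Rightarrow> nat) \<Rightarrow> nat \<Rightarrow> real \<Rightarrow> nat set set pmf" where
  "intersection_graph n \<mu> K P \<alpha> =
     map_pmf (\<lambda>(E, F). E \<inter> F) (pair_pmf (random_key_graph n \<mu> K P) (erdos_renyi_graph n \<alpha>))"

definition edge_prob :: "(nat \<Rightarrow> nat) \<Rightarrow> nat \<Rightarrow> nat \<Rightarrow> nat \<Rightarrow> real" where
  "edge_prob K P i j = 1 - real ((P - K i) choose K j) / real (P choose K j)"

definition mean_edge_prob :: "nat \<Rightarrow> nat pmf \<Rightarrow> (nat \<Rightarrow> nat) \<Rightarrow> nat \<Rightarrow> nat \<Rightarrow> real" where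
  "mean_edge_prob r \<mu> K P i = (\<Sum>j=1..r. pmf \<mu> j * edge_prob K P i j)"

definition total_edge_prob ::
    "nat \<Rightarrow> nat pmf \<Rightarrow> (nat \<Rightarrow> nat) \<Rightarrow> nat \<Rightarrow> real \<Rightarrow> nat \<Rightarrow> real" where
  "total_edge_prob r \<mu> K P \<alpha> i = \<alpha> * mean_edge_prob r \<mu> K P i"

text \<open>\<open>K n i\<close> is \<open>K\<^bsub>i,n\<^esub>\<close>; only the values for \<open>i \<in> {1..r}\<close> matter.\<close>

definition scaling ::
    "nat \<Rightarrow> (nat \<Rightarrow> nat \<Rightarrow> nat) \<Rightarrow> (nat \<Rightarrow> nat) \<Rightarrow> (nat \<Rightarrow> real) \<Rightarrow> bool" where
  "scaling r K P \<alpha> \<longleftrightarrow>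
     (\<forall>n. 0 < \<alpha> n \<and> \<alpha> n < 1) \<and>
     (\<forall>n\<ge>2. 1 \<le> K n 1 \<and> (\<forall>i\<in>{1..<r}. K n i \<le> K n (Suc i)) \<and> real (K n r) \<le> real (P n) / 2)"

end

theory Submission
  imports Defs "HOL-Real_Asymp.Real_Asymp"
begin

text \<open>
  Given the key ring of a class-\<open>i\<close> node, the other nodes are adjacent to it independently
  with probability \<open>\<Lambda>\<^sub>i\<close>, and \<open>\<Lambda>\<^sub>1\<close> is the smallest of these. For \<open>c > 1\<close> a union
  bound gives at most \<open>n (1 - \<Lambda>\<^sub>1)\<^bsup>n-1\<^esup>\<close> isolated nodes in the mean. For \<open>c < 1\<close> the second
  moment method applies to the number of isolated class-1 nodes. Two class-1 nodes with disjoint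
  rings are asymptotically independent, since a third ring meets both with probability
  \<open>O(\<lambda>\<^sub>1\<^sup>2)\<close> (log-concavity of binomial coefficients, and \<open>p\<^sub>1\<^sub>j \<le> \<lambda>\<^sub>1 / \<mu>\<^sub>j\<close>). Intersecting rings, of
  probability \<open>p\<^sub>1\<^sub>1 \<le> \<lambda>\<^sub>1 / \<mu>\<^sub>1\<close>, multiply the joint probability by at most about
  \<open>e\<^sup>s\<close> with \<open>s = n \<alpha> \<Lambda>\<^sub>1\<close>; their excess contribution
  \<open>p\<^sub>1\<^sub>1 (e\<^sup>s - 1) \<le> p\<^sub>1\<^sub>1 s e\<^sup>s\<close> is at most of order \<open>n \<Lambda>\<^sub>1\<^sup>2 n\<^bsup>c+o(1)\<^esup>\<close>, uniformly in \<open>\<alpha>\<close>, and vanishes.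
\<close>

subsection \<open>Independent products and the second moment method\<close>

text \<open>Finite supports reduce Fubini to a finite double sum, for arbitrary real
  \<open>f\<close>.\<close>

lemma expectation_pair_pmf_finite:
  fixes f :: "'a \<times> 'b \<Rightarrow> real"
  assumes "finite (set_pmf p)" "finite (set_pmf q)"
  shows "measure_pmf.expectation (pair_pmf p q) f =
           measure_pmf.expectation p (\<lambda>x. measure_pmf.expectation q (\<lambda>y. f (x, y)))"
proof -
  have "measure_pmf.expectation (pair_pmf p q) f =
          (\<Sum>z\<in>set_pmf p \<times> set_pmf q. f z * pmf (pair_pmf p q) z)"
    by (rule integral_measure_pmf_real) (use assms in auto)
  also have "\<dots> = (\<Sum>x\<in>set_pmf p. (\<Sum>y\<in>set_pmf q. f (x, y) * pmf q y) * pmf p x)"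
    by (subst sum.cartesian_product') (simp add: pmf_pair sum_distrib_left mult_ac)
  also have "\<dots> = (\<Sum>x\<in>set_pmf p. measure_pmf.expectation q (\<lambda>y. f (x, y)) * pmf p x)"
    by (intro sum.cong refl arg_cong2[of _ _ _ _ "(*)"], subst integral_measure_pmf_real[of "set_pmf q"])
       (use assms in auto)
  also have "\<dots> = measure_pmf.expectation p (\<lambda>x. measure_pmf.expectation q (\<lambda>y. f (x, y)))"
    by (subst integral_measure_pmf_real[of "set_pmf p"]) (use assms in auto)
  finally show ?thesis .
qed

lemma finite_set_Pi_pmf:
  assumes "finite A" "\<And>x. x \<in> A \<Longrightarrow> finite (set_pmf (p x))"
  shows "finite (set_pmf (Pi_pmf A d p))"
  using assms by (subst set_Pi_pmf) auto

lemma expectation_Pi_pmf_insert: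
  fixes f :: "('a \<Rightarrow> 'b) \<Rightarrow> real"
  assumes "finite A" "x \<notin> A" "\<And>y. y \<in> insert x A \<Longrightarrow> finite (set_pmf (p y))"
  shows "measure_pmf.expectation (Pi_pmf (insert x A) d p) f =
    measure_pmf.expectation (p x) (\<lambda>a. measure_pmf.expectation (Pi_pmf A d p) (\<lambda>\<omega>. f (fun_upd \<omega> x a)))"
  using assms by (simp add: Pi_pmf_insert expectation_pair_pmf_finite finite_set_Pi_pmf)

lemma expectation_prod_Pi_pmf_iid:
  fixes h :: "'b \<Rightarrow> real"
  assumes "finite A" "finite (set_pmf p)" "\<And>b. h b \<ge> 0"
  shows "measure_pmf.expectation (Pi_pmf A d (\<lambda>_. p)) (\<lambda>\<omega>. \<Prod>y\<in>A. h (\<omega> y)) =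
    measure_pmf.expectation p h ^ card A"
  using assms expectation_prod_Pi_pmf[of A "\<lambda>_. p" "\<lambda>_. h" d]
  by (simp add: integrable_measure_pmf_finite)

text \<open>Conditioning on the value at \<open>v\<close> leaves \<open>card I - 1\<close>
  independent factors with a common law, so their expectations multiply. Later \<open>v\<close> is
  the node tested for isolation and \<open>h\<close> the probability of a missing edge.\<close>

lemma expectation_Pi_pmf_one:
  fixes g :: "'b \<Rightarrow> real" and h :: "'b \<Rightarrow> 'b \<Rightarrow> real"
  assumes "finite I" "v \<in> I" "finite (set_pmf p)" "\<And>a b. h a b \<ge> 0"
  shows "measure_pmf.expectation (Pi_pmf I d (\<lambda>_. p)) (\<lambda>\<omega>. g (\<omega> v) * (\<Prod>y\<in>I-{v}. h (\<omega> v) (\<omega> y))) =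
    measure_pmf.expectation p (\<lambda>a. g a * measure_pmf.expectation p (h a) ^ (card I - 1))"
proof -
  define A where "A = I - {v}"
  have I: "I = insert v A" and A: "finite A" "v \<notin> A" "card A = card I - 1"
    using assms by (auto simp: A_def)
  define F where "F \<omega> = g (\<omega> v) * (\<Prod>y\<in>A. h (\<omega> v) (\<omega> y))" for \<omega>
  have F: "F (fun_upd \<omega> v a) = g a * (\<Prod>y\<in>A. h a (\<omega> y))" for \<omega> a
  proof -
    have "(\<Prod>y\<in>A. h a ((fun_upd \<omega> v a) y)) = (\<Prod>y\<in>A. h a (\<omega> y))"
      using A by (intro prod.cong) auto
    then show ?thesis by (simp add: F_def)
  qed
  have "measure_pmf.expectation (Pi_pmf I d (\<lambda>_. p)) F =
      measure_pmf.expectation p (\<lambda>a.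
        measure_pmf.expectation (Pi_pmf A d (\<lambda>_. p)) (\<lambda>\<omega>. F (fun_upd \<omega> v a)))"
    unfolding I using A assms(3) by (simp add: expectation_Pi_pmf_insert)
  also have "\<dots> = measure_pmf.expectation p (\<lambda>a. g a * measure_pmf.expectation p (h a) ^ card A)"
    unfolding F using A assms(3,4) by (simp add: expectation_prod_Pi_pmf_iid)
  finally show ?thesis
    unfolding F_def A_def[symmetric] A(3) .
qed

text \<open>The same conditioning on two coordinates; \<open>g\<close> takes up whatever depends on
  \<open>u\<close> and \<open>v\<close> alone, later including the edge between them.\<close>

lemma expectation_Pi_pmf_two:
  fixes g :: "'b \<Rightarrow> 'b \<Rightarrow> real" and h :: "'b \<Rightarrow> 'b \<Rightarrow> 'b \<Rightarrow> real"
  assumes "finite I" "u \<in> I" "v \<in> I" "u \<noteq> v" "finite (set_pmf p)" "\<And>a b c. h a b c \<ge> 0"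
  shows "measure_pmf.expectation (Pi_pmf I d (\<lambda>_. p))
      (\<lambda>\<omega>. g (\<omega> u) (\<omega> v) * (\<Prod>y\<in>I-{u,v}. h (\<omega> u) (\<omega> v) (\<omega> y))) =
    measure_pmf.expectation p (\<lambda>a. measure_pmf.expectation p (\<lambda>b.
      g a b * measure_pmf.expectation p (h a b) ^ (card I - 2)))"
proof -
  define A where "A = I - {u,v}"
  have I: "I = insert u (insert v A)" and A: "finite A" "v \<notin> A" "u \<notin> insert v A" "card A = card I - 2"
    using assms by (auto simp: A_def card_Diff_subset)
  define F where "F \<omega> = g (\<omega> u) (\<omega> v) * (\<Prod>y\<in>A. h (\<omega> u) (\<omega> v) (\<omega> y))" for \<omega>
  have F: "F (fun_upd (fun_upd \<omega> v b) u a) = g a b * (\<Prod>y\<in>A. h a b (\<omega> y))" for \<omega> a b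
  proof -
    have "(\<Prod>y\<in>A. h a b ((fun_upd (fun_upd \<omega> v b) u a) y)) = (\<Prod>y\<in>A. h a b (\<omega> y))"
      using A by (intro prod.cong) auto
    then show ?thesis using assms(4) by (simp add: F_def)
  qed
  have "measure_pmf.expectation (Pi_pmf I d (\<lambda>_. p)) F =
      measure_pmf.expectation p (\<lambda>a. measure_pmf.expectation p (\<lambda>b.
        measure_pmf.expectation (Pi_pmf A d (\<lambda>_. p)) (\<lambda>\<omega>. F (fun_upd (fun_upd \<omega> v b) u a))))"
    unfolding I using A assms(5) by (simp add: expectation_Pi_pmf_insert)
  also have "\<dots> = measure_pmf.expectation p (\<lambda>a. measure_pmf.expectation p (\<lambda>b.
      g a b * measure_pmf.expectation p (h a b) ^ card A))"
    unfolding F using A assms(5,6) by (simp add: expectation_prod_Pi_pmf_iid)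
  finally show ?thesis
    unfolding F_def A_def[symmetric] A(4) .
qed

lemma prob_Pi_bernoulli_none:
  assumes "finite A" "B \<subseteq> A" "0 \<le> \<alpha>" "\<alpha> \<le> 1"
  shows "measure_pmf.prob (Pi_pmf A False (\<lambda>_. bernoulli_pmf \<alpha>)) {b. \<forall>e\<in>B. \<not> b e} = (1 - \<alpha>) ^ card B"
proof -
  have "{b. \<forall>e\<in>B. \<not> b e} = Pi A (\<lambda>e. if e \<in> B then {False} else UNIV)"
    using assms(2) by (auto simp: Pi_def)
  then have "measure_pmf.prob (Pi_pmf A False (\<lambda>_. bernoulli_pmf \<alpha>)) {b. \<forall>e\<in>B. \<not> b e} =
      (\<Prod>e\<in>A. if e \<in> B then 1 - \<alpha> else 1)"
    using assms by (auto simp: measure_Pi_pmf_Pi measure_pmf_single intro!: prod.cong)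
  also have "\<dots> = (1 - \<alpha>) ^ card B"
    using assms by (simp add: prod.If_cases Int_absorb1)
  finally show ?thesis .
qed

text \<open>Chebyshev's argument for the number \<open>Z\<close> of events that occur: where
  \<open>Z = 0\<close>, the square of \<open>Z / E Z - 1\<close> equals 1, so this has probability
  at most \<open>E Z^2 / (E Z)^2 - 1\<close>. The diagonal of \<open>E Z^2\<close> gives the first
  term of the bound, the other pairs give \<open>b / a^2\<close>.\<close>

lemma (in prob_space) prob_none_le_second_moment:
  assumes "finite I" "I \<noteq> {}" "\<And>v. v \<in> I \<Longrightarrow> A v \<in> events" "\<And>v. v \<in> I \<Longrightarrow> prob (A v) = a" "a > 0" "b \<ge> 0"
    and "\<And>u v. u \<in> I \<Longrightarrow> v \<in> I \<Longrightarrow> u \<noteq> v \<Longrightarrow> prob (A u \<inter> A v) \<le> b"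
  shows "prob (space M - (\<Union>v\<in>I. A v)) \<le> 1 / (real (card I) * a) + b / a\<^sup>2 - 1"
proof -
  define Z where "Z x = (\<Sum>v\<in>I. indicator (A v) x :: real)" for x
  define k where "k = real (card I)"
  have k: "k > 0" using assms by (simp add: k_def card_gt_0_iff)
  have b: "prob (A u \<inter> A v) \<le> (if u = v then a else 0) + (if u = v then 0 else b)" if "u \<in> I" "v \<in> I" for u v
    using assms that by auto
  have Z2: "(Z x)\<^sup>2 = (\<Sum>u\<in>I. \<Sum>v\<in>I. indicator (A u \<inter> A v) x)" for x
    by (simp add: Z_def power2_eq_square sum_product indicator_inter_arith)
  have ind: "integrable M (indicat_real (A u))" "integrable M (indicat_real (A u \<inter> A v))"
    if "u \<in> I" "v \<in> I" for u v
    using assms that by (auto intro!: integrable_real_indicator simp: emeasure_eq_measure)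
  have int: "integrable M Z" "integrable M (\<lambda>x. (Z x)\<^sup>2)"
    unfolding Z2 unfolding Z_def using ind by (auto intro!: Bochner_Integration.integrable_sum)
  have EZ: "expectation Z = k * a"
    unfolding Z_def using assms ind by (subst Bochner_Integration.integral_sum) (auto simp: k_def)
  have "expectation (\<lambda>x. (Z x)\<^sup>2) = (\<Sum>u\<in>I. \<Sum>v\<in>I. prob (A u \<inter> A v))"
    unfolding Z2 using assms ind by (simp add: Bochner_Integration.integral_sum Bochner_Integration.integrable_sum)
  also have "\<dots> \<le> (\<Sum>u\<in>I. \<Sum>v\<in>I. (if u = v then a else 0) + (if u = v then 0 else b))"
    using b by (intro sum_mono) auto
  also have "\<dots> \<le> (\<Sum>u\<in>I. a + k * b)"
  proof (intro sum_mono)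
    fix u assume u: "u \<in> I"
    \<comment> \<open>Adding the omitted diagonal term back replaces \<open>k - 1\<close> by
      \<open>k\<close>, which keeps the final bound free of a correction in
      \<open>1 / k\<close>.\<close>
    have "(\<Sum>v\<in>I. if u = v then 0 else b) \<le> (\<Sum>v\<in>I. b)"
      using assms by (intro sum_mono) auto
    then show "(\<Sum>v\<in>I. (if u = v then a else 0) + (if u = v then 0 else b)) \<le> a + k * b"
      using u assms(1) by (simp add: sum.distrib k_def)
  qed
  also have "\<dots> = k * a + k\<^sup>2 * b"
    by (simp add: k_def algebra_simps power2_eq_square)
  finally have EZ2: "expectation (\<lambda>x. (Z x)\<^sup>2) \<le> k * a + k\<^sup>2 * b" .
  have ev: "space M - (\<Union>v\<in>I. A v) \<in> events"
    using assms by (intro sets.Diff sets.top sets.finite_UN) auto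
  have "prob (space M - (\<Union>v\<in>I. A v)) = expectation (indicator (space M - (\<Union>v\<in>I. A v)))"
    by (subst Bochner_Integration.integral_indicator, rule arg_cong[of _ _ prob]) auto
  also have "\<dots> \<le> expectation (\<lambda>x. (Z x)\<^sup>2 / (k * a)\<^sup>2 - 2 * Z x / (k * a) + 1)"
  proof (intro integral_mono)
    fix x
    have "(Z x / (k * a) - 1)\<^sup>2 = (Z x)\<^sup>2 / (k * a)\<^sup>2 - 2 * Z x / (k * a) + 1"
      by (simp add: power2_eq_square algebra_simps)
    moreover have "indicator (space M - (\<Union>v\<in>I. A v)) x \<le> (Z x / (k * a) - 1)\<^sup>2"
      by (auto simp: indicator_def Z_def)
    ultimately show "indicator (space M - (\<Union>v\<in>I. A v)) x \<le> (Z x)\<^sup>2 / (k * a)\<^sup>2 - 2 * Z x / (k * a) + 1"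
      by simp
  qed (use int ev in \<open>auto intro!: integrable_real_indicator simp: emeasure_eq_measure\<close>)
  also have "\<dots> = expectation (\<lambda>x. (Z x)\<^sup>2) / (k * a)\<^sup>2 - 2 * expectation Z / (k * a) + 1"
    using int by (simp add: prob_space)
  also have "\<dots> \<le> (k * a + k\<^sup>2 * b) / (k * a)\<^sup>2 - 1"
    using EZ2 EZ k assms by (simp add: divide_right_mono)
  also have "\<dots> = 1 / (k * a) + b / a\<^sup>2 - 1"
    using k assms by (simp add: field_simps power2_eq_square)
  finally show ?thesis by (simp add: k_def)
qed

subsection \<open>Isolated nodes of a randomly thinned graph\<close>

text \<open>A label stands for everything a node carries, later its class and key ring. Related
  labels propose an edge, and an independent coin of bias \<open>\<alpha>\<close> decides whether it
  stays.\<close>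

locale thinned_random_graph =
  fixes \<nu> :: "'a pmf" and R :: "'a \<Rightarrow> 'a \<Rightarrow> bool" and \<alpha> :: real and n :: nat and d :: 'a
  assumes fin: "finite (set_pmf \<nu>)" and sym: "R a b \<Longrightarrow> R b a" and \<alpha>: "0 \<le> \<alpha>" "\<alpha> \<le> 1"
begin

definition edges :: "(nat \<Rightarrow> 'a) \<times> (nat set \<Rightarrow> bool) \<Rightarrow> nat set set" where
  "edges = (\<lambda>(\<omega>, b). {{x, y} | x y. x \<in> {1..n} \<and> y \<in> {1..n} \<and> x \<noteq> y \<and> R (\<omega> x) (\<omega> y)} \<inter>
    {e \<in> node_pairs n. b e})"

definition space_pmf :: "((nat \<Rightarrow> 'a) \<times> (nat set \<Rightarrow> bool)) pmf" where
  "space_pmf = pair_pmf (Pi_pmf {1..n} d (\<lambda>_. \<nu>)) (Pi_pmf (node_pairs n) False (\<lambda>_. bernoulli_pmf \<alpha>))"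

text \<open>Conditional probability, given the labels of two nodes, that no edge joins them.\<close>

definition link :: "'a \<Rightarrow> 'a \<Rightarrow> real" where
  "link a b = (if R a b then 1 - \<alpha> else 1)"

lemma link_nonneg: "link a b \<ge> 0"
  using \<alpha> by (simp add: link_def)

lemma finite_node_pairs: "finite (node_pairs n)"
  by (rule finite_subset[of _ "Pow {1..n}"]) (auto simp: node_pairs_def)

text \<open>Once the labels are given, isolation is the failure of a fixed set of coins, to which
  independence applies.\<close>

lemma isolated_iff:
  assumes "v \<in> {1..n}"
  shows "isolated (edges (\<omega>, b)) v \<longleftrightarrow> (\<forall>e\<in>(\<lambda>y. {v, y}) ` {y \<in> {1..n} - {v}. R (\<omega> v) (\<omega> y)}. \<not> b e)"
    (is "?L \<longleftrightarrow> ?R")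
proof
  assume L: ?L
  show ?R
  proof (safe)
    fix y assume y: "y \<in> {1..n}" "y \<noteq> v" "R (\<omega> v) (\<omega> y)" "b {v, y}"
    then have "{v, y} \<in> edges (\<omega>, b)"
      using assms unfolding edges_def node_pairs_def by blast
    then show False using L by (auto simp: isolated_def)
  qed
next
  assume R: ?R
  show ?L
    unfolding isolated_def
  proof (intro ballI notI)
    fix e assume e: "e \<in> edges (\<omega>, b)" "v \<in> e"
    then obtain x y where xy: "e = {x, y}" "x \<in> {1..n}" "y \<in> {1..n}" "x \<noteq> y" "R (\<omega> x) (\<omega> y)" "b e"
      unfolding edges_def by auto
    then have "v = x \<or> v = y" using e by auto
    \<comment> \<open>An edge does not record which endpoint came first; symmetry of
      \<open>R\<close> allows \<open>v\<close> to be taken as the first.\<close>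
    then obtain z where "e = {v, z}" "z \<in> {1..n} - {v}" "R (\<omega> v) (\<omega> z)"
      using xy sym by (metis DiffI doubleton_eq_iff insert_commute singletonD)
    then show False using R xy(6) by auto
  qed
qed

abbreviation coins :: "(nat set \<Rightarrow> bool) pmf" where
  "coins \<equiv> Pi_pmf (node_pairs n) False (\<lambda>_. bernoulli_pmf \<alpha>)"

lemma prod_link:
  assumes "finite A"
  shows "(\<Prod>y\<in>A. link a (\<omega> y)) = (1 - \<alpha>) ^ card {y \<in> A. R a (\<omega> y)}"
  using assms by (simp add: link_def prod.If_cases Int_def)

text \<open>Different \<open>y\<close> give different pairs \<open>{v, y}\<close>, so exactly as
  many coins must fail as there are related nodes.\<close>

lemma prob_coins_isolated:
  assumes "v \<in> {1..n}"
  shows "measure_pmf.prob coins {b. isolated (edges (\<omega>, b)) v} = (\<Prod>y\<in>{1..n}-{v}. link (\<omega> v) (\<omega> y))"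
proof -
  let ?Y = "{y \<in> {1..n} - {v}. R (\<omega> v) (\<omega> y)}"
  have "inj_on (\<lambda>y. {v, y}) ?Y"
    by (auto simp: inj_on_def doubleton_eq_iff)
  moreover have "(\<lambda>y. {v, y}) ` ?Y \<subseteq> node_pairs n"
    using assms unfolding node_pairs_def by blast
  ultimately show ?thesis
    unfolding isolated_iff[OF assms]
    by (subst prob_Pi_bernoulli_none) (use \<alpha> finite_node_pairs in \<open>auto simp: card_image prod_link\<close>)
qed

text \<open>The pair \<open>{u, v}\<close> is the only one that concerns both nodes. Its coin counts
  once, whence the single factor for \<open>u\<close> and \<open>v\<close>; all other coins are
  distinct.\<close>

lemma prob_coins_both_isolated:
  assumes "u \<in> {1..n}" "v \<in> {1..n}" "u \<noteq> v"
  shows "measure_pmf.prob coins {b. isolated (edges (\<omega>, b)) u \<and> isolated (edges (\<omega>, b)) v} =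
    link (\<omega> u) (\<omega> v) * (\<Prod>y\<in>{1..n}-{u,v}. link (\<omega> u) (\<omega> y) * link (\<omega> v) (\<omega> y))"
proof -
  let ?U = "{y \<in> {1..n} - {u,v}. R (\<omega> u) (\<omega> y)}" and ?V = "{y \<in> {1..n} - {u,v}. R (\<omega> v) (\<omega> y)}"
  \<comment> \<open>\<open>?W\<close> is \<open>{v}\<close> or empty, so the shared edge enters the
    exponent in the same way as the other neighbours.\<close>
  let ?W = "{y \<in> {v}. R (\<omega> u) (\<omega> y)}"
  let ?EU = "(\<lambda>y. {u, y}) ` ?U" and ?EV = "(\<lambda>y. {v, y}) ` ?V" and ?EW = "(\<lambda>y. {u, y}) ` ?W"
  have "{b. isolated (edges (\<omega>, b)) u \<and> isolated (edges (\<omega>, b)) v} = {b. \<forall>e\<in>?EW \<union> (?EU \<union> ?EV). \<not> b e}"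
  proof -
    have eq: "(\<lambda>y. {u, y}) ` {y \<in> {1..n} - {u}. R (\<omega> u) (\<omega> y)} \<union> (\<lambda>y. {v, y}) ` {y \<in> {1..n} - {v}. R (\<omega> v) (\<omega> y)}
      = ?EW \<union> (?EU \<union> ?EV)" (is "?l = ?r")
    proof
      show "?l \<subseteq> ?r"
      proof
        fix e assume "e \<in> ?l"
        then obtain x y where e: "e = {x, y}" "y \<in> {1..n}" "y \<noteq> x" "R (\<omega> x) (\<omega> y)" "x = u \<or> x = v"
          by blast
        show "e \<in> ?r"
        proof (cases "{x, y} = {u, v}")
          case True
          then have "R (\<omega> u) (\<omega> v)" using e(4) sym by (auto simp: doubleton_eq_iff)
          then show ?thesis using True e(1) by auto
        next
          case False
          then have "y \<notin> {u, v}" using e(3,5) by auto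
          then show ?thesis using e by blast
        qed
      qed
      show "?r \<subseteq> ?l" using assms by auto
    qed
    show ?thesis
      unfolding isolated_iff[OF assms(1)] isolated_iff[OF assms(2)] ball_Un[symmetric] eq by (rule refl)
  qed
  moreover have "?EW \<union> (?EU \<union> ?EV) \<subseteq> node_pairs n"
    using assms unfolding node_pairs_def by blast
  moreover have "card (?EW \<union> (?EU \<union> ?EV)) = card ?W + (card ?U + card ?V)"
  proof -
    have "?EW \<inter> (?EU \<union> ?EV) = {}" "?EU \<inter> ?EV = {}"
      using assms(3) by (auto simp: doubleton_eq_iff)
    moreover have "card ?EW = card ?W" "card ?EU = card ?U" "card ?EV = card ?V"
      by (intro card_image; auto simp: inj_on_def doubleton_eq_iff)+
    ultimately show ?thesis by (simp add: card_Un_disjoint)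
  qed
  ultimately have "measure_pmf.prob coins {b. isolated (edges (\<omega>, b)) u \<and> isolated (edges (\<omega>, b)) v} =
      (1 - \<alpha>) ^ (card ?W + (card ?U + card ?V))"
    using \<alpha> finite_node_pairs by (simp add: prob_Pi_bernoulli_none)
  also have "\<dots> = (\<Prod>y\<in>{v}. link (\<omega> u) (\<omega> y)) *
      ((\<Prod>y\<in>{1..n}-{u,v}. link (\<omega> u) (\<omega> y)) * (\<Prod>y\<in>{1..n}-{u,v}. link (\<omega> v) (\<omega> y)))"
    by (simp only: prod_link power_add finite_Diff finite_atLeastAtMost finite.intros)
  finally show ?thesis by (simp add: prod.distrib)
qed

text \<open>The coins are averaged first, for fixed labels; a condition \<open>Q\<close> on the
  labels is then a constant factor.\<close>

lemma prob_space_pmf: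
  "measure_pmf.prob space_pmf {(\<omega>, b). Q \<omega> \<and> S \<omega> b} =
    measure_pmf.expectation (Pi_pmf {1..n} d (\<lambda>_. \<nu>)) (\<lambda>\<omega>. of_bool (Q \<omega>) * measure_pmf.prob coins {b. S \<omega> b})"
proof -
  have "measure_pmf.prob space_pmf {(\<omega>, b). Q \<omega> \<and> S \<omega> b} =
    measure_pmf.expectation space_pmf (indicator {(\<omega>, b). Q \<omega> \<and> S \<omega> b})"
    by simp
  also have "\<dots> = measure_pmf.expectation (Pi_pmf {1..n} d (\<lambda>_. \<nu>)) (\<lambda>\<omega>.
      measure_pmf.expectation coins (\<lambda>b. of_bool (Q \<omega>) * indicator {b. S \<omega> b} b))"
    unfolding space_pmf_def
    by (subst expectation_pair_pmf_finite)
       (auto intro!: finite_set_Pi_pmf fin finite_node_pairs Bochner_Integration.integral_cong simp: indicator_def)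
  finally show ?thesis by simp
qed

lemma prob_isolated:
  assumes "v \<in> {1..n}"
  shows "measure_pmf.prob space_pmf {(\<omega>, b). Q (\<omega> v) \<and> isolated (edges (\<omega>, b)) v} =
    measure_pmf.expectation \<nu> (\<lambda>x. of_bool (Q x) * measure_pmf.expectation \<nu> (link x) ^ (n - 1))"
  unfolding prob_space_pmf prob_coins_isolated[OF assms]
  using expectation_Pi_pmf_one[of "{1..n}" v \<nu> link d "\<lambda>x. of_bool (Q x)"] assms fin link_nonneg by simp

lemma prob_both_isolated:
  assumes "u \<in> {1..n}" "v \<in> {1..n}" "u \<noteq> v"
  shows "measure_pmf.prob space_pmf
      {(\<omega>, b). (Q (\<omega> u) \<and> Q (\<omega> v)) \<and> isolated (edges (\<omega>, b)) u \<and> isolated (edges (\<omega>, b)) v} =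
    measure_pmf.expectation \<nu> (\<lambda>x. measure_pmf.expectation \<nu> (\<lambda>x'. of_bool (Q x \<and> Q x') * link x x' *
      measure_pmf.expectation \<nu> (\<lambda>y. link x y * link x' y) ^ (n - 2)))"
  unfolding prob_space_pmf prob_coins_both_isolated[OF assms]
  using expectation_Pi_pmf_two[of "{1..n}" u v \<nu> "\<lambda>x x' y. link x y * link x' y" d "\<lambda>x x'. of_bool (Q x \<and> Q x') * link x x'"]
    assms fin link_nonneg by (simp add: mult_ac)

section \<open>First and second moment bounds for a thinned graph\<close>

lemma prob_isolated_node_le:
  "1 - measure_pmf.prob space_pmf {z. no_isolated_nodes n (edges z)} \<le>
    real n * measure_pmf.expectation \<nu> (\<lambda>x. measure_pmf.expectation \<nu> (link x) ^ (n - 1))"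
proof -
  let ?A = "\<lambda>v. {(\<omega>, b). True \<and> isolated (edges (\<omega>, b)) v}"
  have "1 - measure_pmf.prob space_pmf {z. no_isolated_nodes n (edges z)} =
      measure_pmf.prob space_pmf (- {z. no_isolated_nodes n (edges z)})"
    using measure_pmf.prob_compl[of "{z. no_isolated_nodes n (edges z)}" space_pmf] by (simp add: Compl_eq_Diff_UNIV)
  also have "- {z. no_isolated_nodes n (edges z)} = (\<Union>v\<in>{1..n}. ?A v)"
    by (auto simp: no_isolated_nodes_def)
  also have "measure_pmf.prob space_pmf (\<Union>v\<in>{1..n}. ?A v) \<le> (\<Sum>v\<in>{1..n}. measure_pmf.prob space_pmf (?A v))"
    by (rule measure_pmf.finite_measure_subadditive_finite) auto
  also have "\<dots> = (\<Sum>v\<in>{1..n}. measure_pmf.expectation \<nu> (\<lambda>x. measure_pmf.expectation \<nu> (link x) ^ (n - 1)))"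
    by (intro sum.cong refl, subst prob_isolated) auto
  finally show ?thesis by simp
qed

text \<open>A graph without isolated nodes has none with a label in \<open>Q\<close>, so for an
  upper bound only these are counted. The nodes are exchangeable, so one \<open>a\<close> serves all
  nodes and one \<open>b\<close> all pairs.\<close>

lemma prob_no_isolated_node_le:
  fixes Q :: "'a \<Rightarrow> bool"
  defines "a \<equiv> measure_pmf.expectation \<nu> (\<lambda>x. of_bool (Q x) * measure_pmf.expectation \<nu> (link x) ^ (n - 1))"
    and "b \<equiv> measure_pmf.expectation \<nu> (\<lambda>x. measure_pmf.expectation \<nu> (\<lambda>x'. of_bool (Q x \<and> Q x') * link x x' *
      measure_pmf.expectation \<nu> (\<lambda>y. link x y * link x' y) ^ (n - 2)))"
  assumes "n \<ge> 1" "a > 0"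
  shows "measure_pmf.prob space_pmf {z. no_isolated_nodes n (edges z)} \<le> 1 / (real n * a) + b / a\<^sup>2 - 1"
proof -
  let ?A = "\<lambda>v. {(\<omega>, b). Q (\<omega> v) \<and> isolated (edges (\<omega>, b)) v}"
  have "measure_pmf.prob space_pmf {z. no_isolated_nodes n (edges z)} \<le>
      measure_pmf.prob space_pmf (space (measure_pmf space_pmf) - (\<Union>v\<in>{1..n}. ?A v))"
    by (intro measure_pmf.finite_measure_mono) (auto simp: no_isolated_nodes_def)
  also have "\<dots> \<le> 1 / (real (card {1..n}) * a) + b / a\<^sup>2 - 1"
  proof (rule measure_pmf.prob_none_le_second_moment)
    show "measure_pmf.prob space_pmf (?A v) = a" if "v \<in> {1..n}" for v
      unfolding a_def by (rule prob_isolated[OF that])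
    show "measure_pmf.prob space_pmf (?A u \<inter> ?A v) \<le> b" if "u \<in> {1..n}" "v \<in> {1..n}" "u \<noteq> v" for u v
    proof -
      have "?A u \<inter> ?A v =
          {(\<omega>, b). (Q (\<omega> u) \<and> Q (\<omega> v)) \<and> isolated (edges (\<omega>, b)) u \<and> isolated (edges (\<omega>, b)) v}"
        by auto
      then show ?thesis unfolding b_def using prob_both_isolated[OF that, of Q] by simp
    qed
    show "b \<ge> 0"
      unfolding b_def using link_nonneg
      by (intro Bochner_Integration.integral_nonneg mult_nonneg_nonneg zero_le_power) auto
  qed (use assms in auto)
  finally show ?thesis by simp
qed

end

subsection \<open>Random key rings\<close>

text \<open>The two sides compare factor by factor: with exact subtraction,
  \<open>(n - s - i) * (n - t - i)\<close> exceeds \<open>(n - s - t - i) * (n - i)\<close> by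
  \<open>s * t\<close>. For key rings this says that avoiding one of two disjoint sets does not make
  avoiding the other more likely.\<close>

lemma binomial_log_concave:
  "((n - s - t) choose k) * (n choose k) \<le> ((n - s) choose k) * ((n - t) choose k)"
proof (cases "k \<le> n - s - t")
  \<comment> \<open>Here the truncated subtractions are exact for every \<open>i < k\<close>;
    otherwise the left side vanishes.\<close>
  case True
  have binomial: "real (a choose k) = (\<Prod>i = 0..<k. real (a - i) / real (k - i))" if "n - s - t \<le> a" for a
    by (rule binomial_altdef_of_nat) (use True that in simp)
  have "real ((n - s - t) choose k) * real (n choose k) =
      (\<Prod>i = 0..<k. (real (n - s - t - i) / real (k - i)) * (real (n - i) / real (k - i)))"
    unfolding prod.distrib by (subst (1 2) binomial) auto
  also have "\<dots> \<le> (\<Prod>i = 0..<k. (real (n - s - i) / real (k - i)) * (real (n - t - i) / real (k - i)))"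
  proof (intro prod_mono conjI)
    fix i assume i: "i \<in> {0..<k}"
    have "real (n - s - t - i) * real (n - i) \<le> real (n - s - i) * real (n - t - i)"
      using i True by (cases "k = 0") (auto simp: of_nat_diff algebra_simps)
    then have "real (n - s - t - i) * real (n - i) / (real (k - i) * real (k - i)) \<le>
        real (n - s - i) * real (n - t - i) / (real (k - i) * real (k - i))"
      by (intro divide_right_mono) auto
    then show "real (n - s - t - i) / real (k - i) * (real (n - i) / real (k - i))
        \<le> real (n - s - i) / real (k - i) * (real (n - t - i) / real (k - i))"
      by simp
  qed auto
  also have "\<dots> = real ((n - s) choose k) * real ((n - t) choose k)"
    unfolding prod.distrib by (subst (1 2) binomial) auto
  finally show ?thesis
    by (metis of_nat_le_iff of_nat_mult)
qed (simp add: binomial_eq_0)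

lemma finite_key_rings: "finite (key_rings P k)"
  by (rule finite_subset[of _ "Pow {1..P}"]) (auto simp: key_rings_def)

lemma card_key_rings: "card (key_rings P k) = P choose k"
  using n_subsets[of "{1..P}" k] by (simp add: key_rings_def)

lemma key_rings_nonempty: "k \<le> P \<Longrightarrow> key_rings P k \<noteq> {}"
  using card_key_rings[of P k] zero_less_binomial[of k P] by force

text \<open>Rings avoiding \<open>S\<close> are the \<open>k\<close>-subsets of its complement, so
  only the size of \<open>S\<close> matters.\<close>

lemma prob_key_ring_avoids:
  assumes "k \<le> P" "S \<subseteq> {1..P}"
  shows "measure_pmf.prob (pmf_of_set (key_rings P k)) {T. S \<inter> T = {}} =
    real ((P - card S) choose k) / real (P choose k)"
proof -
  have "key_rings P k \<inter> {T. S \<inter> T = {}} = {T. T \<subseteq> {1..P} - S \<and> card T = k}"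
    by (auto simp: key_rings_def)
  moreover have "card ({1..P} - S) = P - card S"
    using assms(2) by (simp add: card_Diff_subset finite_subset)
  ultimately show ?thesis
    using assms by (simp add: measure_pmf_of_set finite_key_rings key_rings_nonempty card_key_rings n_subsets)
qed

text \<open>The number \<open>m\<close> is a common positive lower bound for the class
  probabilities; it lets \<open>lam\<close> control each single edge probability. The bound
  \<open>K i \<le> P\<close> keeps every set of key rings nonempty.\<close>

locale key_model =
  fixes r :: nat and \<mu> :: "nat pmf" and K :: "nat \<Rightarrow> nat" and P :: nat and m :: real
  assumes set_pmf_classes: "set_pmf \<mu> = {1..r}" and r: "r \<ge> 1"
    and K_min: "i \<in> {1..r} \<Longrightarrow> K 1 \<le> K i" and K_le: "i \<in> {1..r} \<Longrightarrow> K i \<le> P"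
    and m: "m > 0" "i \<in> {1..r} \<Longrightarrow> m \<le> pmf \<mu> i"
begin

abbreviation \<nu> :: "(nat \<times> nat set) pmf" where "\<nu> \<equiv> node_pmf \<mu> K P"
abbreviation p :: "nat \<Rightarrow> nat \<Rightarrow> real" where "p \<equiv> edge_prob K P"
abbreviation lam :: "nat \<Rightarrow> real" where "lam \<equiv> mean_edge_prob r \<mu> K P"

lemma set_key_ring: "i \<in> {1..r} \<Longrightarrow> set_pmf (pmf_of_set (key_rings P (K i))) = key_rings P (K i)"
  using K_le by (simp add: finite_key_rings key_rings_nonempty)

lemma set_node_pmf: "set_pmf \<nu> = (SIGMA i:{1..r}. key_rings P (K i))"
  unfolding node_pmf_def using set_pmf_classes set_key_ring by (auto simp: set_bind_pmf)

lemma finite_node_pmf: "finite (set_pmf \<nu>)"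
  unfolding set_node_pmf by (auto simp: finite_key_rings)

lemma expectation_node_pmf:
  fixes f :: "nat \<times> nat set \<Rightarrow> real"
  shows "measure_pmf.expectation \<nu> f =
    (\<Sum>i=1..r. pmf \<mu> i * measure_pmf.expectation (pmf_of_set (key_rings P (K i))) (\<lambda>S. f (i, S)))"
  unfolding node_pmf_def
  by (subst pmf_expectation_bind[of "{1..r}"])
     (use set_pmf_classes set_key_ring in \<open>auto simp: finite_key_rings\<close>)

lemma sum_classes: "(\<Sum>i=1..r. pmf \<mu> i) = 1"
  using sum_pmf_eq_1[of "{1..r}" \<mu>] set_pmf_classes by simp

lemma p_nonneg: "p i j \<ge> 0"
  by (simp add: edge_prob_def binomial_right_mono divide_le_eq)

lemma p_le_1: "p i j \<le> 1"
  by (simp add: edge_prob_def)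

lemma p_mono: "K i \<le> K i' \<Longrightarrow> p i j \<le> p i' j"
  by (simp add: edge_prob_def binomial_right_mono divide_right_mono)

lemma lam_nonneg: "lam i \<ge> 0"
  unfolding mean_edge_prob_def by (intro sum_nonneg mult_nonneg_nonneg p_nonneg) auto

lemma lam_mono: "i \<in> {1..r} \<Longrightarrow> lam 1 \<le> lam i"
  unfolding mean_edge_prob_def using K_min by (intro sum_mono mult_left_mono p_mono) auto

lemma lam_le_1: "lam i \<le> 1"
proof -
  have "lam i \<le> (\<Sum>j=1..r. pmf \<mu> j * 1)"
    unfolding mean_edge_prob_def by (intro sum_mono mult_left_mono p_le_1) auto
  then show ?thesis using sum_classes by simp
qed

text \<open>The term for class \<open>j\<close> in the mean has weight at least \<open>m\<close>,
  and all other terms are nonnegative.\<close>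

lemma p_le_lam:
  assumes "j \<in> {1..r}"
  shows "p i j \<le> lam i / m"
proof -
  have "m * p i j \<le> pmf \<mu> j * p i j"
    using assms m p_nonneg by (intro mult_right_mono) auto
  also have "\<dots> \<le> lam i"
    unfolding mean_edge_prob_def using assms p_nonneg
    by (intro member_le_sum) auto
  finally show ?thesis using m by (simp add: field_simps)
qed

text \<open>By inclusion-exclusion the probability is \<open>2 * p i j - 1\<close> plus that of
  avoiding both rings. For disjoint rings log-concavity bounds the latter by
  \<open>(1 - p i j)^2\<close>; in general it is at most \<open>1 - p i j\<close>.\<close>

lemma prob_hits_both:
  assumes "S \<in> key_rings P (K i)" "T \<in> key_rings P (K i)" "i \<in> {1..r}" "j \<in> {1..r}"
  shows "measure_pmf.prob (pmf_of_set (key_rings P (K j))) {U. S \<inter> U \<noteq> {} \<and> T \<inter> U \<noteq> {}} \<le>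
    (if S \<inter> T = {} then p i j ^ 2 else p i j)"
proof -
  let ?M = "pmf_of_set (key_rings P (K j))"
  let ?A = "{U. S \<inter> U = {}}" and ?B = "{U. T \<inter> U = {}}"
  have S: "S \<subseteq> {1..P}" "card S = K i" and T: "T \<subseteq> {1..P}" "card T = K i"
    using assms by (auto simp: key_rings_def)
  have av: "measure_pmf.prob ?M ?A = 1 - p i j" "measure_pmf.prob ?M ?B = 1 - p i j"
    using prob_key_ring_avoids[OF K_le[OF assms(4)]] S T by (simp_all add: edge_prob_def)
  have "{U. S \<inter> U \<noteq> {} \<and> T \<inter> U \<noteq> {}} = UNIV - (?A \<union> ?B)" by auto
  then have "measure_pmf.prob ?M {U. S \<inter> U \<noteq> {} \<and> T \<inter> U \<noteq> {}} = 1 - measure_pmf.prob ?M (?A \<union> ?B)"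
    using measure_pmf.prob_compl[of "?A \<union> ?B" ?M] by simp
  also have "measure_pmf.prob ?M (?A \<union> ?B) =
      measure_pmf.prob ?M ?A + measure_pmf.prob ?M ?B - measure_pmf.prob ?M (?A \<inter> ?B)"
    by (subst measure_pmf.finite_measure_Union') (auto simp: measure_pmf.finite_measure_Diff' Int_commute)
  finally have eq: "measure_pmf.prob ?M {U. S \<inter> U \<noteq> {} \<and> T \<inter> U \<noteq> {}} =
      2 * p i j - 1 + measure_pmf.prob ?M (?A \<inter> ?B)"
    using av by simp
  show ?thesis
  proof (cases "S \<inter> T = {}")
    case False
    have "measure_pmf.prob ?M (?A \<inter> ?B) \<le> measure_pmf.prob ?M ?A"
      by (intro measure_pmf.finite_measure_mono) auto
    then show ?thesis using eq av False by simp
  next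
    case True
    have "?A \<inter> ?B = {U. (S \<union> T) \<inter> U = {}}" by auto
    moreover have "card (S \<union> T) = K i + K i"
      using S T True by (simp add: card_Un_disjoint finite_subset)
    ultimately have "measure_pmf.prob ?M (?A \<inter> ?B) = real ((P - K i - K i) choose K j) / real (P choose K j)"
      using prob_key_ring_avoids[OF K_le[OF assms(4)], of "S \<union> T"] S T by simp
    also have "\<dots> \<le> (1 - p i j) ^ 2"
    proof -
      have pos: "real (P choose K j) > 0" using K_le[OF assms(4)] by simp
      have "real ((P - K i - K i) choose K j) * real (P choose K j) \<le> (real ((P - K i) choose K j))\<^sup>2"
        using binomial_log_concave[of P "K i" "K i" "K j"] unfolding power2_eq_square
        by (metis of_nat_le_iff of_nat_mult)
      then show ?thesis using pos by (simp add: edge_prob_def field_simps power2_eq_square)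
    qed
    finally show ?thesis using eq True by (simp add: power2_eq_square algebra_simps)
  qed
qed

end

subsection \<open>Moments of the number of isolated nodes\<close>

locale key_model_thinned = key_model +
  fixes \<alpha> :: real and n :: nat
  assumes \<alpha>: "0 \<le> \<alpha>" "\<alpha> \<le> 1"
begin

sublocale thinned_random_graph \<nu> "\<lambda>x y. snd x \<inter> snd y \<noteq> {}" \<alpha> n "(0, {})"
  by unfold_locales (use finite_node_pmf \<alpha> in auto)

text \<open>Labels and coins on one product space generate the same law, so the isolation of several
  nodes can be computed by conditioning on labels.\<close>

lemma intersection_graph_eq:
  "intersection_graph n \<mu> K P \<alpha> = map_pmf edges space_pmf"
  unfolding intersection_graph_def random_key_graph_def erdos_renyi_graph_def space_pmf_def
    pair_map_pmf1 pair_map_pmf2 pmf.map_comp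
  by (intro map_pmf_cong refl) (auto simp: edges_def key_graph_def apfst_def apsnd_def map_prod_def)

definition \<Lambda> :: "nat \<Rightarrow> real" where "\<Lambda> i = \<alpha> * lam i"

lemma \<Lambda>_bounds: "0 \<le> \<Lambda> i" "\<Lambda> i \<le> 1" and \<Lambda>_mono: "i \<in> {1..r} \<Longrightarrow> \<Lambda> 1 \<le> \<Lambda> i"
  unfolding \<Lambda>_def using \<alpha> lam_nonneg lam_le_1 lam_mono by (auto intro: mult_left_mono mult_le_one)

section \<open>Averages of the conditional non-edge probabilities\<close>

lemma expectation_of_avoid:
  "measure_pmf.expectation M (\<lambda>U. if S \<inter> U \<noteq> {} then 1 - \<alpha> else 1) =
    1 - \<alpha> + \<alpha> * measure_pmf.prob M {U. S \<inter> U = {}}"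
proof -
  have "(\<lambda>U. if S \<inter> U \<noteq> {} then 1 - \<alpha> else 1) = (\<lambda>U. 1 - \<alpha> + \<alpha> * indicator {U. S \<inter> U = {}} U)"
    by (auto simp: indicator_def)
  then show ?thesis
    by (simp, subst Bochner_Integration.integral_add)
       (auto intro!: integrable_real_indicator simp: measure_pmf.emeasure_eq_measure)
qed

text \<open>All rings of one class have the same size, so the average depends on the label only
  through its class. This makes the isolation probability of a class-\<open>i\<close> node an exact
  power.\<close>

lemma expectation_link:
  assumes "x \<in> set_pmf \<nu>"
  shows "measure_pmf.expectation \<nu> (link x) = 1 - \<Lambda> (fst x)"
proof -
  obtain i S where x: "x = (i, S)" "i \<in> {1..r}" "S \<in> key_rings P (K i)"
    using assms unfolding set_node_pmf by auto
  have "measure_pmf.expectation \<nu> (link x) = (\<Sum>j=1..r. pmf \<mu> j * (1 - \<alpha> * p i j))"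
    unfolding expectation_node_pmf
  proof (intro sum.cong refl)
    fix j assume j: "j \<in> {1..r}"
    have "measure_pmf.expectation (pmf_of_set (key_rings P (K j))) (\<lambda>U. link x (j, U)) = 1 - \<alpha> * p i j"
      using prob_key_ring_avoids[OF K_le[OF j], of S] x
      unfolding link_def by (simp add: expectation_of_avoid key_rings_def edge_prob_def algebra_simps)
    then show "pmf \<mu> j * measure_pmf.expectation (pmf_of_set (key_rings P (K j))) (\<lambda>U. link x (j, U)) =
        pmf \<mu> j * (1 - \<alpha> * p i j)" by simp
  qed
  also have "\<dots> = (\<Sum>j=1..r. pmf \<mu> j) - \<alpha> * lam i"
    unfolding mean_edge_prob_def by (simp add: algebra_simps sum_subtractf sum_distrib_left)
  finally show ?thesis using sum_classes by (simp add: \<Lambda>_def x)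
qed

text \<open>Without its last term the bound is linear in \<open>\<Lambda> i\<close>; the term in
  \<open>\<alpha>\<^sup>2\<close> measures the dependence caused by third rings that meet both
  \<open>S\<close> and \<open>T\<close>.\<close>

lemma expectation_link_link:
  assumes "(i, S) \<in> set_pmf \<nu>" "(i, T) \<in> set_pmf \<nu>"
  shows "measure_pmf.expectation \<nu> (\<lambda>y. link (i, S) y * link (i, T) y) \<le>
    1 - 2 * \<Lambda> i + \<alpha>\<^sup>2 * (if S \<inter> T = {} then lam i ^ 2 / m else lam i)"
proof -
  have i: "i \<in> {1..r}" "S \<in> key_rings P (K i)" "T \<in> key_rings P (K i)"
    using assms unfolding set_node_pmf by auto
  let ?f = "\<lambda>y. link (i, S) y * link (i, T) y"
  let ?H = "{U. S \<inter> U \<noteq> {} \<and> T \<inter> U \<noteq> {}}"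
  \<comment> \<open>A product of two factors of the form \<open>1 - \<alpha> * indicator\<close> is
    expanded; the quadratic term survives only where the ring of \<open>y\<close> meets
    both.\<close>
  have "measure_pmf.expectation \<nu> ?f =
     measure_pmf.expectation \<nu> (\<lambda>y. link (i, S) y + link (i, T) y - 1 + \<alpha>\<^sup>2 * indicator (UNIV \<times> ?H) y)"
    by (intro Bochner_Integration.integral_cong refl) (auto simp: link_def indicator_def power2_eq_square algebra_simps)
  also have "\<dots> = 1 - 2 * \<Lambda> i + \<alpha>\<^sup>2 * measure_pmf.prob \<nu> (UNIV \<times> ?H)"
    by (subst Bochner_Integration.integral_add Bochner_Integration.integral_diff;
        simp add: integrable_measure_pmf_finite finite_node_pmf expectation_link assms)+
  also have "measure_pmf.prob \<nu> (UNIV \<times> ?H) \<le> (if S \<inter> T = {} then lam i ^ 2 / m else lam i)"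
  proof -
    have "measure_pmf.prob \<nu> (UNIV \<times> ?H) = measure_pmf.expectation \<nu> (indicator (UNIV \<times> ?H))" by simp
    also have "\<dots> = (\<Sum>j=1..r. pmf \<mu> j * measure_pmf.prob (pmf_of_set (key_rings P (K j))) ?H)"
    proof -
      have "(\<lambda>U. indicat_real (UNIV \<times> ?H) (j, U)) = indicator ?H" for j :: nat
        by (auto simp: indicator_def)
      then show ?thesis unfolding expectation_node_pmf by simp
    qed
    also have "\<dots> \<le> (\<Sum>j=1..r. pmf \<mu> j * (if S \<inter> T = {} then p i j ^ 2 else p i j))"
      using prob_hits_both i by (intro sum_mono mult_left_mono) auto
    also have "\<dots> \<le> (if S \<inter> T = {} then lam i ^ 2 / m else lam i)"
    proof (cases "S \<inter> T = {}")
      case True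
      \<comment> \<open>One of the two factors \<open>p i j\<close> is replaced by the uniform bound
        \<open>lam i / m\<close>; the other averages to \<open>lam i\<close>.\<close>
      have "(\<Sum>j=1..r. pmf \<mu> j * p i j ^ 2) \<le> (\<Sum>j=1..r. pmf \<mu> j * p i j * (lam i / m))"
        unfolding power2_eq_square mult.assoc by (intro sum_mono mult_left_mono p_le_lam p_nonneg) auto
      also have "\<dots> = lam i ^ 2 / m"
        by (simp add: sum_distrib_right[symmetric] sum_divide_distrib[symmetric] mean_edge_prob_def power2_eq_square)
      finally show ?thesis using True by simp
    qed (simp add: mean_edge_prob_def)
    finally show ?thesis .
  qed
  finally show ?thesis by (simp add: mult_left_mono)
qed

lemma expectation_class:
  assumes "i \<in> {1..r}"
  shows "measure_pmf.expectation \<nu> (\<lambda>x. of_bool (fst x = i) * f (snd x)) =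
    pmf \<mu> i * measure_pmf.expectation (pmf_of_set (key_rings P (K i))) f"
proof -
  have "measure_pmf.expectation \<nu> (\<lambda>x. of_bool (fst x = i) * f (snd x)) =
    (\<Sum>j=1..r. if j = i then pmf \<mu> i * measure_pmf.expectation (pmf_of_set (key_rings P (K i))) f else 0)"
    unfolding expectation_node_pmf by (intro sum.cong) auto
  then show ?thesis using assms by simp
qed

lemma expectation_le:
  fixes f g :: "nat \<times> nat set \<Rightarrow> real"
  assumes "\<And>x. x \<in> set_pmf \<nu> \<Longrightarrow> f x \<le> g x"
  shows "measure_pmf.expectation \<nu> f \<le> measure_pmf.expectation \<nu> g"
  by (intro integral_mono_AE AE_pmfI integrable_measure_pmf_finite finite_node_pmf assms)

lemma expectation_eq:
  fixes f g :: "nat \<times> nat set \<Rightarrow> real"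
  assumes "\<And>x. x \<in> set_pmf \<nu> \<Longrightarrow> f x = g x"
  shows "measure_pmf.expectation \<nu> f = measure_pmf.expectation \<nu> g"
  by (intro integral_cong_AE AE_pmfI assms) auto

section \<open>Bounds on the absence of isolated nodes for fixed \<open>n\<close>\<close>

abbreviation prob_no_isolated :: real where
  "prob_no_isolated \<equiv> measure_pmf.prob (intersection_graph n \<mu> K P \<alpha>) {E. no_isolated_nodes n E}"

lemma prob_no_isolated_eq: "prob_no_isolated = measure_pmf.prob space_pmf {z. no_isolated_nodes n (edges z)}"
  unfolding intersection_graph_eq by (simp add: vimage_def)

lemma prob_no_isolated_ge: "prob_no_isolated \<ge> 1 - real n * (1 - \<Lambda> 1) ^ (n - 1)"
proof -
  have "measure_pmf.expectation \<nu> (\<lambda>x. measure_pmf.expectation \<nu> (link x) ^ (n - 1)) \<le>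
      measure_pmf.expectation \<nu> (\<lambda>x. (1 - \<Lambda> 1) ^ (n - 1))"
  proof (rule expectation_le)
    fix x assume x: "x \<in> set_pmf \<nu>"
    then have "fst x \<in> {1..r}" by (auto simp: set_node_pmf)
    then show "measure_pmf.expectation \<nu> (link x) ^ (n - 1) \<le> (1 - \<Lambda> 1) ^ (n - 1)"
      unfolding expectation_link[OF x] using \<Lambda>_mono \<Lambda>_bounds by (intro power_mono) auto
  qed
  then have "real n * measure_pmf.expectation \<nu> (\<lambda>x. measure_pmf.expectation \<nu> (link x) ^ (n - 1)) \<le>
      real n * (1 - \<Lambda> 1) ^ (n - 1)"
    by (intro mult_left_mono) auto
  then show ?thesis
    using prob_isolated_node_le unfolding prob_no_isolated_eq by linarith
qed

lemma isolated_class_1: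
  "measure_pmf.expectation \<nu> (\<lambda>x. of_bool (fst x = 1) * measure_pmf.expectation \<nu> (link x) ^ (n - 1)) =
    pmf \<mu> 1 * (1 - \<Lambda> 1) ^ (n - 1)"
proof -
  have "measure_pmf.expectation \<nu> (\<lambda>x. of_bool (fst x = 1) * measure_pmf.expectation \<nu> (link x) ^ (n - 1)) =
    measure_pmf.expectation \<nu> (\<lambda>x. of_bool (fst x = 1) * (1 - \<Lambda> 1) ^ (n - 1))"
    by (intro expectation_eq) (auto simp: expectation_link)
  also have "\<dots> = pmf \<mu> 1 * (1 - \<Lambda> 1) ^ (n - 1)"
    using r by (subst expectation_class[of 1 "\<lambda>_. (1 - \<Lambda> 1) ^ (n - 1)"]) auto
  finally show ?thesis .
qed

text \<open>The power of \<open>1 - \<Lambda> 1\<close> is the contribution of the other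
  \<open>N\<close> nodes under independence. The exponents \<open>t\<close> and \<open>s\<close>
  bound the gain for disjoint and for intersecting rings, and the latter case has probability
  \<open>p 1 1\<close>.\<close>

lemma both_isolated_class_1:
  fixes s t :: real
  assumes L: "\<Lambda> 1 < 1"
  defines "N \<equiv> n - 2"
  defines "s \<equiv> real N * (\<alpha>\<^sup>2 * lam 1 / (1 - \<Lambda> 1)\<^sup>2)"
    and "t \<equiv> real N * (\<alpha>\<^sup>2 * (lam 1 ^ 2 / m) / (1 - \<Lambda> 1)\<^sup>2)"
  shows "measure_pmf.expectation \<nu> (\<lambda>x. measure_pmf.expectation \<nu> (\<lambda>x'. of_bool (fst x = 1 \<and> fst x' = 1) * link x x' *
      measure_pmf.expectation \<nu> (\<lambda>y. link x y * link x' y) ^ N)) \<le>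
    (pmf \<mu> 1)\<^sup>2 * ((1 - \<Lambda> 1) ^ (2 * N) * (exp t + p 1 1 * (exp s - 1)))" (is "?lhs \<le> _")
proof -
  define D where "D = (1 - \<Lambda> 1) ^ (2 * N)"
  have D: "D \<ge> 0" using \<Lambda>_bounds by (simp add: D_def)
  have st: "s \<ge> 0" "t \<ge> 0" unfolding s_def t_def using lam_nonneg m by auto
  have r1: "(1::nat) \<in> {1..r}" using r by simp
  \<comment> \<open>The independent value is factored out by \<open>1 - 2x \<le> (1 - x)^2\<close>,
    and the remaining \<open>1 + z\<close> is at most \<open>exp z\<close>. Nonnegativity of the
    base makes taking powers monotone.\<close>
  have power_bound: "(1 - 2 * \<Lambda> 1 + \<alpha>\<^sup>2 * q) ^ N \<le> D * exp (real N * (\<alpha>\<^sup>2 * q / (1 - \<Lambda> 1)\<^sup>2))"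
    if "1 - 2 * \<Lambda> 1 + \<alpha>\<^sup>2 * q \<ge> 0" for q
  proof -
    let ?z = "\<alpha>\<^sup>2 * q / (1 - \<Lambda> 1)\<^sup>2"
    have "1 - 2 * \<Lambda> 1 + \<alpha>\<^sup>2 * q \<le> (1 - \<Lambda> 1)\<^sup>2 + \<alpha>\<^sup>2 * q"
      by (simp add: power2_eq_square algebra_simps)
    also have "\<dots> = (1 - \<Lambda> 1)\<^sup>2 * (1 + ?z)"
      using L by (simp add: field_simps)
    also have "\<dots> \<le> (1 - \<Lambda> 1)\<^sup>2 * exp ?z"
      by (intro mult_left_mono exp_ge_add_one_self) auto
    finally have "(1 - 2 * \<Lambda> 1 + \<alpha>\<^sup>2 * q) ^ N \<le> ((1 - \<Lambda> 1)\<^sup>2 * exp ?z) ^ N"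
      using that by (intro power_mono)
    then show ?thesis
      by (simp only: power_mult_distrib power_mult exp_of_nat_mult D_def)
  qed
  have pointwise: "link x x' * measure_pmf.expectation \<nu> (\<lambda>y. link x y * link x' y) ^ N \<le>
      D * (exp t + (exp s - 1) * indicator {U. snd x \<inter> U \<noteq> {}} (snd x'))"
    if x: "x \<in> set_pmf \<nu>" "fst x = 1" "x' \<in> set_pmf \<nu>" "fst x' = 1" for x x'
  proof -
    obtain S T where ST: "x = (1, S)" "x' = (1, T)" using x by (metis prod.collapse)
    define e where "e = measure_pmf.expectation \<nu> (\<lambda>y. link x y * link x' y)"
    have e0: "e \<ge> 0" unfolding e_def using link_nonneg by (intro Bochner_Integration.integral_nonneg) auto
    have e: "e \<le> 1 - 2 * \<Lambda> 1 + \<alpha>\<^sup>2 * (if S \<inter> T = {} then lam 1 ^ 2 / m else lam 1)"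
      using expectation_link_link[of 1 S T] x ST by (simp add: e_def)
    have "link x x' * e ^ N \<le> e ^ N"
      using e0 \<alpha> by (intro mult_left_le_one_le) (auto simp: link_def)
    also have "\<dots> \<le> (1 - 2 * \<Lambda> 1 + \<alpha>\<^sup>2 * (if S \<inter> T = {} then lam 1 ^ 2 / m else lam 1)) ^ N"
      using e e0 by (intro power_mono)
    also have "\<dots> \<le> D * exp (if S \<inter> T = {} then t else s)"
      using power_bound[of "if S \<inter> T = {} then lam 1 ^ 2 / m else lam 1"] e e0
      by (auto simp: s_def t_def split: if_splits)
    \<comment> \<open>For intersecting rings \<open>exp t \<ge> 1\<close> gives
      \<open>exp s \<le> exp t + exp s - 1\<close>; for disjoint ones the indicator
      vanishes.\<close>
    also have "\<dots> \<le> D * (exp t + (exp s - 1) * indicator {U. snd x \<inter> U \<noteq> {}} (snd x'))"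
      using D st ST by (intro mult_left_mono) (auto simp: indicator_def)
    finally show ?thesis by (simp add: e_def)
  qed
  have inner: "measure_pmf.expectation \<nu> (\<lambda>x'. of_bool (fst x = 1 \<and> fst x' = 1) * link x x' *
      measure_pmf.expectation \<nu> (\<lambda>y. link x y * link x' y) ^ N) \<le>
      of_bool (fst x = 1) * (pmf \<mu> 1 * (D * (exp t + (exp s - 1) * p 1 1)))"
    if x: "x \<in> set_pmf \<nu>" for x
  proof (cases "fst x = 1")
    case True
    let ?H = "{U. snd x \<inter> U \<noteq> {}}"
    let ?U = "pmf_of_set (key_rings P (K 1))"
    have S: "snd x \<subseteq> {1..P}" "card (snd x) = K 1"
      using x True by (auto simp: set_node_pmf key_rings_def)
    have "measure_pmf.expectation \<nu> (\<lambda>x'. of_bool (fst x = 1 \<and> fst x' = 1) * link x x' *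
        measure_pmf.expectation \<nu> (\<lambda>y. link x y * link x' y) ^ N) \<le>
      measure_pmf.expectation \<nu> (\<lambda>x'. of_bool (fst x' = 1) * (D * (exp t + (exp s - 1) * indicator ?H (snd x'))))"
      using pointwise[OF x True] True by (intro expectation_le) (auto simp: mult.assoc)
    also have "\<dots> = pmf \<mu> 1 * measure_pmf.expectation ?U (\<lambda>U. D * (exp t + (exp s - 1) * indicator ?H U))"
      by (rule expectation_class[OF r1])
    also have "measure_pmf.expectation ?U (\<lambda>U. D * (exp t + (exp s - 1) * indicator ?H U)) =
        D * (exp t + (exp s - 1) * measure_pmf.prob ?U ?H)"
      by (simp, subst Bochner_Integration.integral_add)
        (auto intro!: integrable_real_indicator simp: measure_pmf.emeasure_eq_measure)
    also have "measure_pmf.prob ?U ?H = 1 - measure_pmf.prob ?U {U. snd x \<inter> U = {}}"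
      using measure_pmf.prob_compl[of "{U. snd x \<inter> U = {}}" ?U]
      by (simp add: Compl_eq_Diff_UNIV[symmetric] Collect_neg_eq)
    also have "\<dots> = p 1 1"
      using prob_key_ring_avoids[OF K_le[OF r1] S(1)] S(2) by (simp add: edge_prob_def)
    finally show ?thesis using True by simp
  qed simp
  have "?lhs \<le> measure_pmf.expectation \<nu> (\<lambda>x. of_bool (fst x = 1) * (pmf \<mu> 1 * (D * (exp t + (exp s - 1) * p 1 1))))"
    by (intro expectation_le inner)
  also have "\<dots> = pmf \<mu> 1 * (pmf \<mu> 1 * (D * (exp t + (exp s - 1) * p 1 1)))"
    by (subst expectation_class[OF r1, of "\<lambda>_. pmf \<mu> 1 * (D * (exp t + (exp s - 1) * p 1 1))"]) simp
  finally show ?thesis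
    by (simp add: D_def power2_eq_square mult_ac)
qed

text \<open>The right side involves \<open>\<alpha>\<close> and \<open>lam 1\<close> only through
  their product \<open>\<Lambda> 1\<close>, the one quantity whose asymptotics are given.\<close>

lemma prob_no_isolated_le:
  assumes n: "n \<ge> 2" and L: "\<Lambda> 1 < 1"
  defines "u \<equiv> real n * \<Lambda> 1 / (1 - \<Lambda> 1)\<^sup>2"
  shows "prob_no_isolated \<le> 1 / (real n * (pmf \<mu> 1 * (1 - \<Lambda> 1) ^ (n - 1))) +
    (exp (u * \<Lambda> 1 / m) + u * \<Lambda> 1 / m * exp u) / (1 - \<Lambda> 1)\<^sup>2 - 1"
proof -
  define s where "s = real (n - 2) * (\<alpha>\<^sup>2 * lam 1 / (1 - \<Lambda> 1)\<^sup>2)"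
  define t where "t = real (n - 2) * (\<alpha>\<^sup>2 * (lam 1 ^ 2 / m) / (1 - \<Lambda> 1)\<^sup>2)"
  define a where "a = pmf \<mu> 1 * (1 - \<Lambda> 1) ^ (n - 1)"
  define b where "b = measure_pmf.expectation \<nu> (\<lambda>x. measure_pmf.expectation \<nu> (\<lambda>x'. of_bool (fst x = 1 \<and> fst x' = 1) * link x x' *
      measure_pmf.expectation \<nu> (\<lambda>y. link x y * link x' y) ^ (n - 2)))"
  have r1: "(1::nat) \<in> {1..r}" using r by simp
  have \<mu>1: "pmf \<mu> 1 > 0" using m(1) m(2)[OF r1] by linarith
  have a: "a > 0" using \<mu>1 L by (simp add: a_def)
  have u0: "u \<ge> 0" unfolding u_def using \<Lambda>_bounds by simp
  have t_le: "t \<le> u * \<Lambda> 1 / m"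
  proof -
    have "t = real (n - 2) * ((\<Lambda> 1)\<^sup>2 / m / (1 - \<Lambda> 1)\<^sup>2)"
      by (simp add: t_def \<Lambda>_def power_mult_distrib)
    also have "\<dots> \<le> real n * ((\<Lambda> 1)\<^sup>2 / m / (1 - \<Lambda> 1)\<^sup>2)"
      using m by (intro mult_right_mono) auto
    finally show ?thesis by (simp add: u_def power2_eq_square mult_ac)
  qed
  have s0: "s \<ge> 0" unfolding s_def using lam_nonneg by simp
  have s_eq: "s = real (n - 2) * \<alpha> * \<Lambda> 1 / (1 - \<Lambda> 1)\<^sup>2"
    by (simp add: s_def \<Lambda>_def power2_eq_square)
  \<comment> \<open>The factor \<open>\<alpha>\<close> is kept: below it joins the
    \<open>lam 1\<close> from the bound on \<open>p 1 1\<close> to form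
    \<open>\<Lambda> 1\<close>.\<close>
  have s_le': "s \<le> \<alpha> * u"
    unfolding s_eq u_def using \<alpha> \<Lambda>_bounds by (auto simp: mult_ac intro!: divide_right_mono mult_mono)
  have s_le: "s \<le> u"
    using s_le' \<alpha> u0 mult_right_mono[of \<alpha> 1 u] by linarith
  have "p 1 1 * (exp s - 1) \<le> lam 1 / m * (\<alpha> * u * exp u)"
  proof (intro mult_mono)
    \<comment> \<open>Multiplying \<open>1 - s \<le> exp (- s)\<close> by \<open>exp s\<close> gives
      \<open>exp s - 1 \<le> s * exp s\<close>, a bound that stays linear in the small factor
      \<open>\<alpha>\<close>.\<close>
    have "(1 - s) * exp s \<le> exp (- s) * exp s"
      using exp_ge_add_one_self[of "- s"] by (intro mult_right_mono) auto
    then have "exp s - 1 \<le> s * exp s"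
      by (simp add: algebra_simps flip: exp_add)
    also have "\<dots> \<le> (\<alpha> * u) * exp u"
      using s_le' s_le \<alpha> u0 by (intro mult_mono) auto
    finally show "exp s - 1 \<le> \<alpha> * u * exp u" .
  qed (use p_le_lam r1 s0 lam_nonneg m in auto)
  also have "\<dots> = u * \<Lambda> 1 / m * exp u"
    by (simp add: \<Lambda>_def mult_ac)
  finally have bracket: "exp t + p 1 1 * (exp s - 1) \<le> exp (u * \<Lambda> 1 / m) + u * \<Lambda> 1 / m * exp u"
    using t_le by (intro add_mono) auto
  \<comment> \<open>One isolated node involves \<open>n - 1\<close> others, a pair only
    \<open>n - 2\<close> further ones; the surplus in \<open>a\<^sup>2\<close> is the divisor
    \<open>(1 - \<Lambda> 1)\<^sup>2\<close>.\<close>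
  have a_sq: "a\<^sup>2 = (pmf \<mu> 1)\<^sup>2 * ((1 - \<Lambda> 1) ^ (2 * (n - 2)) * (1 - \<Lambda> 1)\<^sup>2)"
  proof -
    have "2 * (n - 1) = 2 * (n - 2) + 2" using n by simp
    then have "(1 - \<Lambda> 1) ^ (2 * (n - 1)) = (1 - \<Lambda> 1) ^ (2 * (n - 2)) * (1 - \<Lambda> 1)\<^sup>2"
      by (metis power_add)
    then show ?thesis by (simp add: a_def power_mult_distrib power_even_eq)
  qed
  have "b / a\<^sup>2 \<le> (pmf \<mu> 1)\<^sup>2 * ((1 - \<Lambda> 1) ^ (2 * (n - 2)) * (exp t + p 1 1 * (exp s - 1))) / a\<^sup>2"
    unfolding b_def s_def t_def by (intro divide_right_mono both_isolated_class_1 L) auto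
  also have "\<dots> = (exp t + p 1 1 * (exp s - 1)) / (1 - \<Lambda> 1)\<^sup>2"
    unfolding a_sq using \<mu>1 L by (simp add: field_simps)
  also have "\<dots> \<le> (exp (u * \<Lambda> 1 / m) + u * \<Lambda> 1 / m * exp u) / (1 - \<Lambda> 1)\<^sup>2"
    using bracket by (intro divide_right_mono) auto
  finally have "b / a\<^sup>2 \<le> (exp (u * \<Lambda> 1 / m) + u * \<Lambda> 1 / m * exp u) / (1 - \<Lambda> 1)\<^sup>2" .
  moreover have "prob_no_isolated \<le> 1 / (real n * a) + b / a\<^sup>2 - 1"
    using prob_no_isolated_node_le[of "\<lambda>x. fst x = 1"] n a
    unfolding prob_no_isolated_eq isolated_class_1 b_def a_def by simp
  ultimately show ?thesis by (simp add: a_def)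
qed

end

subsection \<open>The critical scaling\<close>

text \<open>For \<open>d\<close> strictly between 1 and \<open>c\<close>, eventually
  \<open>L n \<ge> d * ln n / n\<close>, so the sequence is at most of order
  \<open>n^(1 - d)\<close>.\<close>

lemma union_bound_tendsto_0:
  fixes L :: "nat \<Rightarrow> real"
  assumes "L \<sim>[sequentially] (\<lambda>n. c * (ln (real n) / real n))" "c > 1" "\<And>n. n \<ge> 2 \<Longrightarrow> L n \<le> 1"
  shows "(\<lambda>n. real n * (1 - L n) ^ (n - 1)) \<longlonglongrightarrow> 0"
proof -
  define d where "d = (1 + c) / 2"
  have d: "d > 1" "d < c" using assms(2) by (simp_all add: d_def)
  \<comment> \<open>Asymptotic equivalence allows common zeros; the comparison sequence is nonzero
    from \<open>n = 2\<close> on, so the quotient really tends to 1.\<close>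
  have "eventually (\<lambda>n. c * (ln (real n) / real n) \<noteq> 0) sequentially"
    using eventually_ge_at_top[of 2] by eventually_elim (use assms(2) in auto)
  then have lim: "(\<lambda>n. L n / (c * (ln (real n) / real n))) \<longlonglongrightarrow> 1"
    using assms(1) by (intro asymp_equivD_strong) (auto elim: eventually_mono)
  have "d / c < 1" using d by simp
  then have "eventually (\<lambda>n. L n / (c * (ln (real n) / real n)) > d / c) sequentially"
    by (rule order_tendstoD(1)[OF lim])
  then have ev: "eventually (\<lambda>n. norm (real n * (1 - L n) ^ (n - 1)) \<le>
      real n * exp (- (real n - 1) * (d * ln (real n) / real n))) sequentially"
    using eventually_ge_at_top[of 2]
  proof eventually_elim
    case (elim n)
    define g where "g = ln (real n) / real n"
    have "g > 0" using elim(2) by (simp add: g_def)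
    then have "d * g < L n"
      using elim(1) d unfolding g_def[symmetric] by (simp add: field_simps)
    then have L: "d * ln (real n) / real n \<le> L n" by (simp add: g_def)
    have "(1 - L n) ^ (n - 1) \<le> exp (- L n) ^ (n - 1)"
      using assms(3)[OF elim(2)] exp_ge_add_one_self[of "- L n"] by (intro power_mono) auto
    also have "\<dots> = exp (- (real n - 1) * L n)"
      using elim(2) by (simp flip: exp_of_nat_mult add: of_nat_diff left_diff_distrib)
    also have "\<dots> \<le> exp (- (real n - 1) * (d * ln (real n) / real n))"
      using mult_left_mono_neg[OF L, of "- (real n - 1)"] elim(2) by simp
    finally show ?case
      using assms(3)[OF elim(2)] by (simp add: abs_mult mult_left_mono)
  qed
  have "(\<lambda>n. real n * exp (- (real n - 1) * (d * ln (real n) / real n))) \<longlonglongrightarrow> 0"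
    using d(1) by real_asymp
  then show ?thesis using ev by (rule Lim_null_comparison[rotated])
qed

text \<open>For \<open>d\<close> strictly between \<open>c\<close> and 1, eventually
  \<open>u n \<le> d * ln n\<close>, so \<open>exp (u n)\<close> is at most \<open>n^d\<close>. The
  expected count then diverges and the correlation terms vanish.\<close>

lemma second_moment_bound_tendsto_0:
  fixes L :: "nat \<Rightarrow> real" and m \<mu>1 :: real
  assumes "L \<sim>[sequentially] (\<lambda>n. c * (ln (real n) / real n))" "0 < c" "c < 1" "\<And>n. n \<ge> 2 \<Longrightarrow> 0 \<le> L n"
    and "m > 0" "\<mu>1 > 0"
  defines "u \<equiv> \<lambda>n. real n * L n / (1 - L n)\<^sup>2"
  shows "(\<lambda>n. 1 / (real n * (\<mu>1 * (1 - L n) ^ (n - 1))) +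
    (exp (u n * L n / m) + u n * L n / m * exp (u n)) / (1 - L n)\<^sup>2 - 1) \<longlonglongrightarrow> 0"
    and "eventually (\<lambda>n. L n < 1) sequentially"
proof -
  define d where "d = (1 + c) / 2"
  have d: "d < 1" "d > c" "d > 0" using assms(2,3) by (simp_all add: d_def)
  have "eventually (\<lambda>n. c * (ln (real n) / real n) \<noteq> 0) sequentially"
    using eventually_ge_at_top[of 2] by eventually_elim (use assms(2) in auto)
  then have lim: "(\<lambda>n. L n / (c * (ln (real n) / real n))) \<longlonglongrightarrow> 1"
    using assms(1) by (intro asymp_equivD_strong) (auto elim: eventually_mono)
  have "(\<lambda>n. c * (ln (real n) / real n)) \<longlonglongrightarrow> 0" by real_asymp
  then have L0: "L \<longlonglongrightarrow> 0"
    using tendsto_asymp_equiv_cong[OF assms(1)] by simp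
  show ev1: "eventually (\<lambda>n. L n < 1) sequentially"
    using order_tendstoD(2)[OF L0, of 1] by simp
  \<comment> \<open>This quotient equals \<open>u n / ln n\<close> for large \<open>n\<close>, and
    its limit \<open>c\<close> lies below \<open>d\<close>.\<close>
  have "(\<lambda>n. c * (L n / (c * (ln (real n) / real n))) / (1 - L n)\<^sup>2) \<longlonglongrightarrow> c * 1 / (1 - 0)\<^sup>2"
    by (intro tendsto_intros lim L0) auto
  then have "eventually (\<lambda>n. c * (L n / (c * (ln (real n) / real n))) / (1 - L n)\<^sup>2 < d) sequentially"
    using d by (intro order_tendstoD(2)) auto
  then have ev: "eventually (\<lambda>n. n \<ge> 2 \<and> L n < 1 \<and> 0 \<le> u n \<and> u n \<le> d * ln (real n) \<and> L n \<le> d * ln (real n) / real n) sequentially"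
    using ev1 eventually_ge_at_top[of 2]
  proof eventually_elim
    case (elim n)
    have u: "c * (L n / (c * (ln (real n) / real n))) / (1 - L n)\<^sup>2 = u n / ln (real n)"
      using assms(2) elim by (simp add: u_def field_simps)
    have u_le: "u n \<le> d * ln (real n)"
      using elim(1,3) unfolding u by (simp add: field_simps)
    have L: "0 \<le> L n" using assms(4) elim by simp
    have "(1 - L n)\<^sup>2 \<le> 1" using L elim(2) by (simp add: power_le_one)
    then have "L n * (1 - L n)\<^sup>2 \<le> L n" using L by (simp add: mult_left_le)
    then have "real n * L n \<le> u n"
      using elim(2) by (simp add: u_def pos_le_divide_eq mult_left_mono mult.assoc)
    then have "L n \<le> d * ln (real n) / real n"
      using u_le elim(3) by (simp add: field_simps)
    then show ?case using elim u_le L by (simp add: u_def)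
  qed
  have lim1: "(\<lambda>n. 1 / (real n * (\<mu>1 * (1 - L n) ^ (n - 1)))) \<longlonglongrightarrow> 0"
  proof (rule Lim_null_comparison)
    show "eventually (\<lambda>n. norm (1 / (real n * (\<mu>1 * (1 - L n) ^ (n - 1)))) \<le> exp ((d - 1) * ln (real n)) / \<mu>1) sequentially"
      using ev
    proof eventually_elim
      case (elim n)
      then have n: "n \<ge> 2" "0 \<le> L n" "L n < 1" "u n \<le> d * ln (real n)" using assms(4) by auto
      \<comment> \<open>The odds \<open>w\<close> turn the reciprocal into
        \<open>1 / (1 - L n) = 1 + w \<le> exp w\<close>, an upper bound for the reciprocal power;
        \<open>u n\<close> dominates \<open>(n - 1) * w\<close>.\<close>
      define w where "w = L n / (1 - L n)"
      have w: "w \<ge> 0" using n by (simp add: w_def)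
      have "1 / (1 - L n) = 1 + w" using n by (simp add: w_def field_simps)
      also have "\<dots> \<le> exp w" by (rule exp_ge_add_one_self)
      finally have "(1 / (1 - L n)) ^ (n - 1) \<le> exp w ^ (n - 1)"
        using n by (intro power_mono) auto
      also have "\<dots> = exp (real (n - 1) * w)" by (rule exp_of_nat_mult[symmetric])
      also have "real (n - 1) * w \<le> u n"
      proof -
        have "real (n - 1) * w \<le> real n * w" using w by (intro mult_right_mono) auto
        also have "w \<le> L n / (1 - L n)\<^sup>2"
          unfolding w_def using n by (intro divide_left_mono) (auto simp: power2_eq_square mult_left_le)
        then have "real n * w \<le> u n" unfolding u_def times_divide_eq_right[symmetric] by (intro mult_left_mono) auto
        finally show ?thesis .
      qed
      also have "u n \<le> d * ln (real n)" by fact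
      finally have "(1 / (1 - L n)) ^ (n - 1) \<le> exp (d * ln (real n))" by simp
      then have "(1 / (1 - L n)) ^ (n - 1) / (real n * \<mu>1) \<le> exp (d * ln (real n)) / (real n * \<mu>1)"
        using assms(6) by (intro divide_right_mono) auto
      also have "exp (d * ln (real n)) / (real n * \<mu>1) = exp ((d - 1) * ln (real n)) / \<mu>1"
        using n by (simp add: left_diff_distrib exp_diff)
      finally show ?case
        using n assms(6) by (simp add: power_one_over field_simps)
    qed
    show "(\<lambda>n. exp ((d - 1) * ln (real n)) / \<mu>1) \<longlonglongrightarrow> 0"
      using d assms(6) by real_asymp
  qed
  have lim2: "(\<lambda>n. u n * L n / m) \<longlonglongrightarrow> 0"
  proof (rule Lim_null_comparison)
    show "eventually (\<lambda>n. norm (u n * L n / m) \<le> d * ln (real n) * (d * ln (real n) / real n) / m) sequentially"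
      using ev
    proof eventually_elim
      case (elim n)
      then have "0 \<le> L n" using assms(4) by auto
      then have "u n * L n \<le> d * ln (real n) * (d * ln (real n) / real n)"
        using elim d by (intro mult_mono) auto
      then have "u n * L n / m \<le> d * ln (real n) * (d * ln (real n) / real n) / m"
        using assms(5) by (intro divide_right_mono) auto
      then show ?case using elim \<open>0 \<le> L n\<close> assms(5) by simp
    qed
    show "(\<lambda>n. d * ln (real n) * (d * ln (real n) / real n) / m) \<longlonglongrightarrow> 0"
      using d(3) assms(5) by real_asymp
  qed
  \<comment> \<open>The decisive term: \<open>u n * L n\<close> is of order at most
    \<open>ln^2 n / n\<close> and \<open>exp (u n)\<close> at most \<open>n^d\<close>, so
    \<open>d < 1\<close> forces decay.\<close>
  have lim3: "(\<lambda>n. u n * L n / m * exp (u n)) \<longlonglongrightarrow> 0"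
  proof (rule Lim_null_comparison)
    show "eventually (\<lambda>n. norm (u n * L n / m * exp (u n)) \<le>
        d * ln (real n) * (d * ln (real n) / real n) / m * exp (d * ln (real n))) sequentially"
      using ev
    proof eventually_elim
      case (elim n)
      then have L: "0 \<le> L n" using assms(4) by auto
      then have "u n * L n \<le> d * ln (real n) * (d * ln (real n) / real n)"
        using elim d by (intro mult_mono) auto
      then have "u n * L n / m \<le> d * ln (real n) * (d * ln (real n) / real n) / m"
        using assms(5) by (intro divide_right_mono) auto
      then have "u n * L n / m * exp (u n) \<le> d * ln (real n) * (d * ln (real n) / real n) / m * exp (d * ln (real n))"
        using elim d assms(5) by (intro mult_mono) auto
      then show ?case using elim L assms(5) by simp
    qed
    show "(\<lambda>n. d * ln (real n) * (d * ln (real n) / real n) / m * exp (d * ln (real n))) \<longlonglongrightarrow> 0"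
      using d(1,3) assms(5) by real_asymp
  qed
  have "(\<lambda>n. 1 / (real n * (\<mu>1 * (1 - L n) ^ (n - 1))) +
    (exp (u n * L n / m) + u n * L n / m * exp (u n)) / (1 - L n)\<^sup>2 - 1) \<longlonglongrightarrow> 0 + (exp 0 + 0) / (1 - 0)\<^sup>2 - 1"
    by (intro tendsto_add tendsto_diff tendsto_divide tendsto_exp tendsto_power tendsto_const lim1 lim2 lim3 L0) auto
  then show "(\<lambda>n. 1 / (real n * (\<mu>1 * (1 - L n) ^ (n - 1))) +
    (exp (u n * L n / m) + u n * L n / m * exp (u n)) / (1 - L n)\<^sup>2 - 1) \<longlonglongrightarrow> 0"
    by simp
qed

section \<open>Passage to the limit in both regimes\<close>

theorem theorem3p1:
  fixes r :: nat and \<mu> :: "nat pmf"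
    and K :: "nat \<Rightarrow> nat \<Rightarrow> nat" and P :: "nat \<Rightarrow> nat" and \<alpha> :: "nat \<Rightarrow> real"
    and c :: real
  assumes "r \<ge> 1"
    and "set_pmf \<mu> = {1..r}"
    and "scaling r K P \<alpha>"
    and "c > 0"
    and "(\<lambda>n. total_edge_prob r \<mu> (K n) (P n) (\<alpha> n) 1) \<sim>[sequentially]
           (\<lambda>n. c * (ln (real n) / real n))"
  shows "(c < 1 \<longrightarrow>
            (\<lambda>n. measure_pmf.prob (intersection_graph n \<mu> (K n) (P n) (\<alpha> n))
                   {E. no_isolated_nodes n E}) \<longlonglongrightarrow> 0) \<and>
         (c > 1 \<longrightarrow>
            (\<lambda>n. measure_pmf.prob (intersection_graph n \<mu> (K n) (P n) (\<alpha> n))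
                   {E. no_isolated_nodes n E}) \<longlonglongrightarrow> 1)"
proof -
  \<comment> \<open>A minimum over finitely many positive probabilities; since \<open>\<mu>\<close>
    is fixed, it bounds them uniformly in \<open>n\<close>.\<close>
  define m where "m = Min (pmf \<mu> ` {1..r})"
  define L where "L n = total_edge_prob r \<mu> (K n) (P n) (\<alpha> n) 1" for n
  let ?f = "\<lambda>n. measure_pmf.prob (intersection_graph n \<mu> (K n) (P n) (\<alpha> n)) {E. no_isolated_nodes n E}"
  have \<mu>_pos: "pmf \<mu> i > 0" if "i \<in> {1..r}" for i
    using that assms(2) by (simp flip: set_pmf_iff add: pmf_positive)
  then have m: "m > 0" "\<And>i. i \<in> {1..r} \<Longrightarrow> m \<le> pmf \<mu> i"
    using assms(1) by (auto simp: m_def)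
  \<comment> \<open>A scaling constrains the ring sizes only from \<open>n = 2\<close> on, which
    suffices for statements about the limit.\<close>
  have model: "key_model_thinned r \<mu> (K n) (P n) m (\<alpha> n)" if n: "n \<ge> 2" for n
  proof
    have \<alpha>: "0 < \<alpha> n" "\<alpha> n < 1"
      and step: "\<And>i. i \<in> {1..<r} \<Longrightarrow> K n i \<le> K n (Suc i)" and top: "real (K n r) \<le> real (P n) / 2"
      using assms(3) n unfolding scaling_def by auto
    have mono: "K n i \<le> K n j" if "i \<le> j" "1 \<le> i" "j \<le> r" for i j
      using that
    proof (induction j rule: dec_induct)
      case (step k)
      then show ?case using \<open>\<And>i. i \<in> {1..<r} \<Longrightarrow> K n i \<le> K n (Suc i)\<close>[of k] by auto
    qed simp
    show "K n 1 \<le> K n i" if "i \<in> {1..r}" for i using mono[of 1 i] that by auto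
    show "K n i \<le> P n" if "i \<in> {1..r}" for i using mono[of i r] that top by auto
    show "0 \<le> \<alpha> n" "\<alpha> n \<le> 1" using \<alpha> by auto
  qed (use assms m in auto)
  have L: "key_model_thinned.\<Lambda> r \<mu> (K n) (P n) (\<alpha> n) 1 = L n" if "n \<ge> 2" for n
    by (simp add: key_model_thinned.\<Lambda>_def[OF model[OF that]] L_def total_edge_prob_def)
  have L_bounds: "0 \<le> L n" "L n \<le> 1" if "n \<ge> 2" for n
    using key_model_thinned.\<Lambda>_bounds[OF model[OF that], of 1] unfolding L[OF that] by auto
  have asymp: "L \<sim>[sequentially] (\<lambda>n. c * (ln (real n) / real n))"
    using assms(5) unfolding L_def .
  show ?thesis
  proof (intro conjI impI)
    assume c: "c < 1"
    note bound = second_moment_bound_tendsto_0[OF asymp assms(4) c L_bounds(1) m(1) \<mu>_pos[of 1]]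
    show "?f \<longlonglongrightarrow> 0"
    proof (rule tendsto_sandwich[OF _ _ tendsto_const bound(1)])
      have "eventually (\<lambda>n. L n < 1) sequentially" using bound(2) assms(1) by simp
      then show "eventually (\<lambda>n. ?f n \<le> 1 / (real n * (pmf \<mu> 1 * (1 - L n) ^ (n - 1))) +
        (exp (real n * L n / (1 - L n)\<^sup>2 * L n / m) +
          real n * L n / (1 - L n)\<^sup>2 * L n / m * exp (real n * L n / (1 - L n)\<^sup>2)) / (1 - L n)\<^sup>2 - 1) sequentially"
        using eventually_ge_at_top[of 2]
      proof eventually_elim
        case (elim n)
        then show ?case
          using key_model_thinned.prob_no_isolated_le[OF model[OF elim(2)] elim(2)] unfolding L[OF elim(2)] by simp
      qed
    qed (use assms(1) in auto)
  next
    assume c: "c > 1"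
    have "(\<lambda>n. 1 - real n * (1 - L n) ^ (n - 1)) \<longlonglongrightarrow> 1 - 0"
      by (intro tendsto_diff tendsto_const union_bound_tendsto_0[OF asymp c L_bounds(2)])
    then have lower: "(\<lambda>n. 1 - real n * (1 - L n) ^ (n - 1)) \<longlonglongrightarrow> 1" by simp
    show "?f \<longlonglongrightarrow> 1"
    proof (rule tendsto_sandwich[OF _ _ lower tendsto_const])
      show "eventually (\<lambda>n. 1 - real n * (1 - L n) ^ (n - 1) \<le> ?f n) sequentially"
        using eventually_ge_at_top[of 2]
      proof eventually_elim
        case (elim n)
        then show ?case
          using key_model_thinned.prob_no_isolated_ge[OF model[OF elim], of n] unfolding L[OF elim] by simp
      qed
    qed (use measure_pmf.prob_le_1 in auto)
  qed
qed

end
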